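(* The set $R_b(\infty)$ is a distributive lattice with $$s(p\vee q)_i = \min(s(p)_i,s(q)_i) \quad\text{and}\quad s(p\wedge q)_i = \max(s(p)_i,s(q)_i)$$ for all $p$ and $q$ in $R_b(\infty)$. Moreover, for all $n$ the functions $$\pi : s=(s_1,s_2,\dots,s_k) \longmapsto \pi(s)=(\infty,s_2,\dots,s_k)$$ and $$\tau : s=(s_1,s_2,\dots,s_k) \longmapsto \tau(s)=(\infty,s_1,s_2,\dots,s_k)$$ are lattice embeddings of $R_b(n)$ into $R_b(\infty)$.
   Context: Fix an integer $b>1$. A $b$-ary partition of a non-negative integer $n$ is a tuple $(p_0,p_1,\dots,p_{k-1})$ of non-negative integers with $p_{k-1}\neq 0$ and $n=\sum_i p_i b^i$. The evolution rule (firing $i$) is: $p \to q$ if $p_i \ge b$, $q_i = p_i - b$, $q_{i+1} = p_{i+1}+1$ (with $p_k=0$ if needed), and $q_j=p_j$ for all other $j$; $q$ is called a successor of $p$. $R_b(n)$ denotes the set of $b$-ary partitions of $n$ reachable from the one-part partition $(n)$ by iterating this rule, ordered by the reflexive and transitive closure of the successor relation; it is a distributive lattice containing all $b$-ary partitions of $n$, with $s(p\vee q)_i=\min(s(p)_i,s(q)_i)$ and $s(p\wedge q)_i=\max(s(p)_i,s(q)_i)$. $R_b(\infty)$ denotes the set of all tuples reachable from $(\infty)$ (first component infinite) by iterating the same rule, ordered by the reflexive and transitive closure of the successor relation. The shot vector $s(p)$ of an element $p$ (of $R_b(n)$, resp. $R_b(\infty)$) is defined by: $s(p)_i$ is the number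 of times one must fire $i$ to obtain $p$ from $(n)$ (resp. from $(\infty)$); it is independent of the firing sequence used. In $R_b(n)$, $p\le q$ iff $s(p)_i\ge s(q)_i$ for all $i$. *)

theory Defs
  imports "HOL-Library.Extended_Nat" "HOL-Algebra.Lattice"
begin

text \<open>
  Tuples \<open>(p\<^sub>0, \<dots>, p\<^sub>k\<^sub>-\<^sub>1)\<close> are lists: of type \<^typ>\<open>nat list\<close> for partitions of an integer and of type
  \<^typ>\<open>enat list\<close> when the first part is infinite. The firing rule is polymorphic, so that both cases
  obey literally the same rule; on \<^typ>\<open>enat\<close> one has \<open>\<infinity> - b = \<infinity>\<close>, so the first part stays infinite.
\<close>

definition fire :: "nat \<Rightarrow> nat \<Rightarrow> 'a::{semiring_1, minus} list \<Rightarrow> 'a list" where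
  "fire b i p =
     (let p' = (if Suc i = length p then p @ [0] else p)
      in p'[i := p' ! i - of_nat b, Suc i := p' ! Suc i + 1])"

definition fireable :: "nat \<Rightarrow> nat \<Rightarrow> 'a::{semiring_1, minus, ord} list \<Rightarrow> bool" where
  "fireable b i p \<longleftrightarrow> i < length p \<and> of_nat b \<le> p ! i"

definition successor :: "nat \<Rightarrow> 'a::{semiring_1, minus, ord} list \<Rightarrow> 'a list \<Rightarrow> bool" where
  "successor b p q \<longleftrightarrow> (\<exists>i. fireable b i p \<and> q = fire b i p)"

fun firing_sequence ::
  "nat \<Rightarrow> 'a::{semiring_1, minus, ord} list \<Rightarrow> nat list \<Rightarrow> 'a list \<Rightarrow> bool" where
  "firing_sequence b p [] q \<longleftrightarrow> q = p"
| "firing_sequence b p (i # is) q \<longleftrightarrow> fireable b i p \<and> firing_sequence b (fire b i p) is q"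

text \<open>
  The description is meaningful because the count is the same for all firing sequences
  from the initial configuration \<open>p\<^sub>0\<close> to \<open>p\<close>.
\<close>

definition shot_vector ::
  "nat \<Rightarrow> 'a::{semiring_1, minus, ord} list \<Rightarrow> 'a list \<Rightarrow> nat \<Rightarrow> nat" where
  "shot_vector b p\<^sub>0 p i = (THE m. \<exists>is. firing_sequence b p\<^sub>0 is p \<and> count_list is i = m)"

definition bary_partition :: "nat \<Rightarrow> nat \<Rightarrow> nat list \<Rightarrow> bool" where
  "bary_partition b n p \<longleftrightarrow>
     (p \<noteq> [] \<longrightarrow> last p \<noteq> 0) \<and> n = (\<Sum>i<length p. p ! i * b ^ i)"

text \<open>Since last parts are nonzero, the only partition of \<open>0\<close> is the empty tuple.\<close>

definition one_part :: "nat \<Rightarrow> nat list" where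
  "one_part n = (if n = 0 then [] else [n])"

text \<open>
  The initial configuration is the greatest element: \<open>p \<le> q\<close> iff \<open>p\<close> can be reached from \<open>q\<close>.
\<close>

definition R :: "nat \<Rightarrow> nat \<Rightarrow> nat list gorder" where
  "R b n =
     \<lparr>carrier = {p. bary_partition b n p \<and> (successor b)\<^sup>*\<^sup>* (one_part n) p},
      eq = (=),
      le = (\<lambda>p q. (successor b)\<^sup>*\<^sup>* q p)\<rparr>"

definition R_inf :: "nat \<Rightarrow> enat list gorder" where
  "R_inf b =
     \<lparr>carrier = {p. (successor b)\<^sup>*\<^sup>* [\<infinity>] p},
      eq = (=),
      le = (\<lambda>p q. (successor b)\<^sup>*\<^sup>* q p)\<rparr>"

definition shot_inf :: "nat \<Rightarrow> enat list \<Rightarrow> nat \<Rightarrow> nat" where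
  "shot_inf b = shot_vector b [\<infinity>]"

locale distributive_lattice = lattice +
  assumes meet_join_distrib:
    "\<lbrakk>x \<in> carrier L; y \<in> carrier L; z \<in> carrier L\<rbrakk> \<Longrightarrow> x \<sqinter> (y \<squnion> z) = (x \<sqinter> y) \<squnion> (x \<sqinter> z)"

text \<open>\<^const>\<open>join_pres\<close> and \<^const>\<open>meet_pres\<close> already include that both structures are lattices.\<close>

definition lattice_embedding ::
  "('a, 'c) gorder_scheme \<Rightarrow> ('b, 'd) gorder_scheme \<Rightarrow> ('a \<Rightarrow> 'b) \<Rightarrow> bool" where
  "lattice_embedding L M f \<longleftrightarrow>
     f \<in> carrier L \<rightarrow> carrier M \<and> inj_on f (carrier L) \<and> join_pres L M f \<and> meet_pres L M f"

text \<open>On the empty tuple (the case \<open>n = 0\<close>) both maps give \<open>(\<infinity>)\<close>.\<close>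

definition proj_inf :: "nat list \<Rightarrow> enat list" where
  "proj_inf s = \<infinity> # map enat (tl s)"

definition shift_inf :: "nat list \<Rightarrow> enat list" where
  "shift_inf s = \<infinity> # map enat s"

end

theory Submission
  imports Defs
begin

text \<open>
  A configuration is determined by its shot vector \<open>s\<close>: the part at position \<open>i + 1\<close> is
  \<open>s\<^sub>i - b s\<^sub>i\<^sub>+\<^sub>1\<close>. Hence the shot vectors of \<open>R\<^sub>b(\<infinity>)\<close> are exactly the sequences with
  \<open>b s\<^sub>i\<^sub>+\<^sub>1 \<le> s\<^sub>i\<close>, a set closed under pointwise minimum and maximum, and reachability is the
  pointwise order: if \<open>s \<le> t\<close> and \<open>s \<noteq> t\<close>, the least \<open>i\<close> with \<open>s\<^sub>i < t\<^sub>i\<close> can be fired.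
  The map \<open>\<tau>\<close> identifies \<open>R\<^sub>b(n)\<close> with the sublattice \<open>s\<^sub>0 = n\<close> (index \<open>0\<close> is never fired again),
  and \<open>\<pi>\<close> drops the entry \<open>s\<^sub>0\<close>; both therefore preserve minima and maxima.
\<close>

section \<open>Posets dual to a sublattice of a product of chains\<close>

text \<open>The order is reversed because more firings lead downwards, so joins come from pointwise
  minima and meets from pointwise maxima. Distributivity is inherited from the linear order on
  \<open>'k\<close>.\<close>

locale dual_function_lattice =
  fixes L :: "('a, 'c) gorder_scheme" (structure)
    and f :: "('i \<Rightarrow> 'k::linorder) \<Rightarrow> 'a" and V :: "('i \<Rightarrow> 'k) set"
  assumes carrier_eq: "carrier L = f ` V"
    and eq_eq: "eq L = (=)"
    and le_iff: "\<lbrakk>s \<in> V; t \<in> V\<rbrakk> \<Longrightarrow> f s \<sqsubseteq> f t \<longleftrightarrow> t \<le> s"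
    and min_closed: "\<lbrakk>s \<in> V; t \<in> V\<rbrakk> \<Longrightarrow> (\<lambda>i. min (s i) (t i)) \<in> V"
    and max_closed: "\<lbrakk>s \<in> V; t \<in> V\<rbrakk> \<Longrightarrow> (\<lambda>i. max (s i) (t i)) \<in> V"
begin

lemma partial_order_L: "partial_order L"
  by unfold_locales (auto simp: eq_eq carrier_eq le_iff)

lemma least_min:
  assumes "s \<in> V" "t \<in> V"
  shows "least L (f (\<lambda>i. min (s i) (t i))) (Upper L {f s, f t})"
  using assms min_closed[OF assms]
  by (auto simp: least_def Upper_def carrier_eq le_iff le_fun_def)

lemma greatest_max:
  assumes "s \<in> V" "t \<in> V"
  shows "greatest L (f (\<lambda>i. max (s i) (t i))) (Lower L {f s, f t})"
  using assms max_closed[OF assms]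
  by (auto simp: greatest_def Lower_def carrier_eq le_iff le_fun_def)

lemma lattice_L: "lattice L"
proof -
  interpret partial_order L by (rule partial_order_L)
  show ?thesis
    by unfold_locales (auto simp: carrier_eq intro: least_min greatest_max)
qed

lemma join_eq:
  assumes "s \<in> V" "t \<in> V"
  shows "f s \<squnion> f t = f (\<lambda>i. min (s i) (t i))"
proof -
  interpret lattice L by (rule lattice_L)
  show ?thesis
    by (rule joinI) (use assms least_unique least_min in \<open>auto simp: carrier_eq\<close>)
qed

lemma meet_eq:
  assumes "s \<in> V" "t \<in> V"
  shows "f s \<sqinter> f t = f (\<lambda>i. max (s i) (t i))"
proof -
  interpret lattice L by (rule lattice_L)
  show ?thesis
    by (rule meetI) (use assms greatest_unique greatest_max in \<open>auto simp: carrier_eq\<close>)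
qed

lemma distributive: "distributive_lattice L"
proof -
  interpret lattice L by (rule lattice_L)
  show ?thesis
    by unfold_locales
      (auto simp: carrier_eq join_eq meet_eq min_closed max_closed max_min_distrib2)
qed

end

section \<open>Configurations parametrized by shot vectors\<close>

definition shots :: "nat \<Rightarrow> (nat \<Rightarrow> nat) set" where
  "shots b = {s. \<forall>i. b * s (Suc i) \<le> s i}"

definition support_length :: "(nat \<Rightarrow> nat) \<Rightarrow> nat" where
  "support_length s = (LEAST k. s k = 0)"

text \<open>On \<open>shots b\<close> the truncated subtraction is exact. Cutting at the first zero
  makes the last part the last positive entry of \<open>s\<close>.\<close>

definition parts :: "nat \<Rightarrow> (nat \<Rightarrow> nat) \<Rightarrow> nat list" where
  "parts b s = map (\<lambda>i. s i - b * s (Suc i)) [0..<support_length s]"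

definition config :: "nat \<Rightarrow> (nat \<Rightarrow> nat) \<Rightarrow> enat list" where
  "config b s = shift_inf (parts b s)"

lemma shotsD: "s \<in> shots b \<Longrightarrow> b * s (Suc i) \<le> s i"
  by (simp add: shots_def)

lemma shots_min:
  assumes "s \<in> shots b" "t \<in> shots b"
  shows "(\<lambda>i. min (s i) (t i)) \<in> shots b"
  unfolding shots_def
proof (intro CollectI allI min.boundedI)
  fix i
  have "b * min (s (Suc i)) (t (Suc i)) \<le> b * s (Suc i)"
    and "b * min (s (Suc i)) (t (Suc i)) \<le> b * t (Suc i)"
    by (intro mult_left_mono; simp)+
  then show "b * min (s (Suc i)) (t (Suc i)) \<le> s i" "b * min (s (Suc i)) (t (Suc i)) \<le> t i"
    using shotsD[OF assms(1), of i] shotsD[OF assms(2), of i] by linarith+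
qed

lemma shots_max:
  assumes "s \<in> shots b" "t \<in> shots b"
  shows "(\<lambda>i. max (s i) (t i)) \<in> shots b"
  unfolding shots_def
proof (intro CollectI allI)
  fix i
  show "b * max (s (Suc i)) (t (Suc i)) \<le> max (s i) (t i)"
    using shotsD[OF assms(1), of i] shotsD[OF assms(2), of i] by (auto simp: max_def)
qed

lemma support_length_eqI:
  assumes "\<And>i. s i = 0 \<longleftrightarrow> k \<le> i"
  shows "support_length s = k"
  unfolding support_length_def by (rule Least_equality) (auto simp: assms)

lemma length_parts [simp]: "length (parts b s) = support_length s"
  by (simp add: parts_def)

lemma nth_parts [simp]: "i < support_length s \<Longrightarrow> parts b s ! i = s i - b * s (Suc i)"
  by (simp add: parts_def)

lemma length_config [simp]: "length (config b s) = Suc (support_length s)"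
  by (simp add: config_def shift_inf_def)

lemma nth_config_0 [simp]: "config b s ! 0 = \<infinity>"
  by (simp add: config_def shift_inf_def)

lemma nth_config_Suc [simp]:
  "i < support_length s \<Longrightarrow> config b s ! Suc i = enat (s i - b * s (Suc i))"
  by (simp add: config_def shift_inf_def)

lemma inj_shift_inf: "inj shift_inf"
  by (auto simp: shift_inf_def inj_on_def inj_map_eq_map)

context
  fixes b :: nat
  assumes b: "b > 1"
begin

lemma shots_zero: "(\<lambda>_. 0) \<in> shots b"
  by (simp add: shots_def)

lemma shots_single: "(\<lambda>i. if i = 0 then n else 0) \<in> shots b"
  by (simp add: shots_def)

lemma shots_tail: "s \<in> shots b \<Longrightarrow> s \<circ> Suc \<in> shots b"
  by (simp add: shots_def)

lemma shots_le: "s \<in> shots b \<Longrightarrow> s (Suc i) \<le> s i"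
  using shotsD[of s b i] b by (metis le_trans less_imp_le mult.commute mult_le_mono2 nat_mult_1_right)

lemma shots_antimono: "\<lbrakk>s \<in> shots b; i \<le> j\<rbrakk> \<Longrightarrow> s j \<le> s i"
  by (rule lift_Suc_antimono_le[of s]) (auto simp: shots_le)

text \<open>Each entry is at most half its predecessor, so entries drop by at least one per step
  until they reach 0. This forces finite support.\<close>

lemma shots_bound:
  assumes "s \<in> shots b"
  shows "s i \<le> s 0 - i"
proof (induction i)
  case (Suc i)
  have "2 * s (Suc i) \<le> b * s (Suc i)" using b by simp
  with shotsD[OF assms, of i] Suc show ?case by linarith
qed simp

lemma shots_eq_0_iff:
  assumes "s \<in> shots b"
  shows "s i = 0 \<longleftrightarrow> support_length s \<le> i"
proof
  \<comment> \<open>The bound \<open>s 0 - i\<close> vanishes at \<open>i = s 0\<close>, which gives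
    \<open>LEAST\<close> a witness.\<close>
  have "s (s 0) = 0" using shots_bound[OF assms, of "s 0"] by simp
  then have "s (support_length s) = 0" unfolding support_length_def by (rule LeastI)
  then show "support_length s \<le> i \<Longrightarrow> s i = 0" using shots_antimono[OF assms] by fastforce
qed (auto simp: support_length_def Least_le)

text \<open>The length fixes where both vectors start to vanish, and the parts fix the differences;
  downward recursion from there recovers every entry.\<close>

lemma config_inject:
  assumes s: "s \<in> shots b" and t: "t \<in> shots b" and eq: "config b s = config b t"
  shows "s = t"
proof
  have len: "support_length s = support_length t"
    using arg_cong[OF eq, of length] by simp
  have diff: "s i - b * s (Suc i) = t i - b * t (Suc i)" for i
  proof (cases "i < support_length s")
    case True
    then show ?thesis using arg_cong[OF eq, of "\<lambda>p. p ! Suc i"] len by simp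
  next
    case False
    then have "s i = 0" "t i = 0" using shots_eq_0_iff s t len by simp_all
    then show ?thesis by simp
  qed
  fix i
  show "s i = t i"
  proof (cases "i \<le> support_length s")
    case True
    then show ?thesis
    proof (induction rule: inc_induct)
      case base
      show ?case
        using shots_eq_0_iff[OF s, of "support_length s"]
          shots_eq_0_iff[OF t, of "support_length s"] len
        by simp
    next
      case (step i)
      then show ?case using diff[of i] shotsD[OF s, of i] shotsD[OF t, of i] by simp
    qed
  next
    case False
    then show ?thesis using shots_eq_0_iff[OF s, of i] shots_eq_0_iff[OF t, of i] len by simp
  qed
qed

lemma config_zero: "config b (\<lambda>_. 0) = [\<infinity>]"
  by (simp add: config_def parts_def shift_inf_def support_length_eqI[of _ 0])

text \<open>Raising \<open>s i\<close> relaxes the inequality with the next entry and tightens only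
  the one with the previous entry, which then says that the part to be fired is at least
  \<open>b\<close>. Index 0 has no previous entry, and its part is infinite.\<close>

lemma fireable_config:
  assumes s: "s \<in> shots b"
  shows "fireable b i (config b s) \<longleftrightarrow> s(i := Suc (s i)) \<in> shots b"
proof (cases i)
  case 0
  have "s(0 := Suc (s 0)) \<in> shots b"
    using s by (auto simp: shots_def intro: le_SucI)
  then show ?thesis by (simp add: 0 fireable_def)
next
  case (Suc k)
  have "s(i := Suc (s i)) \<in> shots b \<longleftrightarrow> b * Suc (s i) \<le> s k"
    using s unfolding Suc by (auto simp: shots_def intro: le_SucI)
  \<comment> \<open>Outside the support \<open>s k = 0\<close>, so both sides fail.\<close>
  also have "\<dots> \<longleftrightarrow> k < support_length s \<and> b \<le> s k - b * s i"
    using shots_eq_0_iff[OF s, of k] shotsD[OF s, of k] b unfolding Suc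
    by (cases "k < support_length s") auto
  also have "\<dots> \<longleftrightarrow> fireable b i (config b s)"
    by (auto simp: fireable_def Suc of_nat_eq_enat)
  finally show ?thesis ..
qed

lemma fire_config:
  assumes s: "s \<in> shots b" and s': "s(i := Suc (s i)) \<in> shots b"
  shows "fire b i (config b s) = config b (s(i := Suc (s i)))"
proof -
  let ?s = "s(i := Suc (s i))" and ?k = "support_length s"
  define p where "p = (if Suc i = length (config b s) then config b s @ [0] else config b s)"
  have i: "i \<le> ?k"
    using fireable_config[OF s, of i] s' by (simp add: fireable_def)
  have len: "support_length ?s = max ?k (Suc i)"
    using i by (intro support_length_eqI) (auto simp: shots_eq_0_iff[OF s])
  have len_p: "length p = Suc (max ?k (Suc i))"
    using i by (auto simp: p_def max_def)
  \<comment> \<open>If the last part is fired, the appended zero still fits the formula because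
    \<open>s j = 0\<close> there.\<close>
  have nth_p: "p ! Suc j = enat (s j - b * s (Suc j))" if "j \<le> i \<or> j < ?k" for j
  proof (cases "j < ?k")
    case True
    then show ?thesis by (simp add: p_def nth_append)
  next
    case False
    then have "j = i" "i = ?k" "s j = 0" using that i shots_eq_0_iff[OF s, of j] by auto
    then show ?thesis by (simp add: p_def nth_append zero_enat_def)
  qed
  have nth_p0: "p ! 0 = \<infinity>" by (simp add: p_def nth_append)
  have "p[i := p ! i - of_nat b, Suc i := p ! Suc i + 1] = config b ?s"
  proof (rule nth_equalityI)
    fix j assume "j < length (p[i := p ! i - of_nat b, Suc i := p ! Suc i + 1])"
    then have j: "j < Suc (max ?k (Suc i))" by (simp add: len_p)
    show "p[i := p ! i - of_nat b, Suc i := p ! Suc i + 1] ! j = config b ?s ! j"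
    proof (cases j)
      case 0
      then show ?thesis using nth_p0 by (simp add: nth_list_update len_p)
    next
      case (Suc l)
      have l: "l \<le> i \<or> l < ?k" "l < max ?k (Suc i)" using j Suc by auto
      \<comment> \<open>Position \<open>Suc l\<close> of the tuple belongs to \<open>l\<close>: the
        part that gains 1 has \<open>l = i\<close>, the part that loses \<open>b\<close> has
        \<open>Suc l = i\<close>.\<close>
      have "?s l - b * ?s (Suc l) =
         (if l = i then s l - b * s (Suc l) + 1
          else if Suc l = i then s l - b * s (Suc l) - b else s l - b * s (Suc l))"
        using shotsD[OF s, of l] by auto
      then show ?thesis
        using nth_p[OF l(1)] l len by (auto simp: Suc nth_list_update len_p of_nat_eq_enat one_enat_def)
    qed
  qed (simp add: len len_p)
  then show ?thesis by (simp add: fire_def Let_def p_def)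
qed

section \<open>Reachability\<close>

text \<open>Each firing adds 1 to one entry, so the end of a run depends only on the firing counts.
  By \<open>config_inject\<close> the end determines the counts in turn.\<close>

lemma firing_sequence_config:
  assumes "firing_sequence b (config b s) is q" "s \<in> shots b"
  shows "(\<lambda>i. s i + count_list is i) \<in> shots b \<and> q = config b (\<lambda>i. s i + count_list is i)"
  using assms
proof (induction "is" arbitrary: s)
  case (Cons i js)
  let ?s = "s(i := Suc (s i))"
  have s': "?s \<in> shots b" using Cons.prems fireable_config by simp
  then have "firing_sequence b (config b ?s) js q"
    using Cons.prems fire_config by simp
  note IH = Cons.IH[OF this s']
  have "(\<lambda>j. ?s j + count_list js j) = (\<lambda>j. s j + count_list (i # js) j)"
    by auto
  with IH show ?case by (simp only:)
qed simp

text \<open>Induction on the total deficit of \<open>s\<close> against \<open>t\<close>, a finite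
  sum because both vanish beyond the support of \<open>t\<close>.\<close>

lemma firing_sequence_exists:
  assumes "s \<in> shots b" "t \<in> shots b" "s \<le> t"
  shows "\<exists>is. firing_sequence b (config b s) is (config b t)"
  using assms
proof (induction "\<Sum>i<support_length t. t i - s i" arbitrary: s rule: less_induct)
  case less
  note s = less.prems(1) and t = less.prems(2) and le = less.prems(3)
  show ?case
  proof (cases "s = t")
    case True
    then show ?thesis by (metis firing_sequence.simps(1))
  next
    case False
    then have "\<exists>i. s i < t i" using le by (metis ext le_funD le_neq_implies_less)
    then obtain i where i: "s i < t i" and min: "\<And>j. j < i \<Longrightarrow> \<not> s j < t j"
      using exists_least_iff[of "\<lambda>i. s i < t i"] by blast
    let ?s = "s(i := Suc (s i))"
    \<comment> \<open>Minimality of \<open>i\<close> gives \<open>t k \<le> s k\<close>, so the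
      constraint is inherited from \<open>t\<close>.\<close>
    have "b * Suc (s (Suc k)) \<le> s k" if "i = Suc k" for k
    proof -
      have "b * Suc (s i) \<le> b * t i" using i by (intro mult_left_mono) auto
      also have "\<dots> \<le> t k" using shotsD[OF t, of k] that by simp
      also have "\<dots> \<le> s k" using min[of k] that by simp
      finally show ?thesis by (simp add: that)
    qed
    then have s': "?s \<in> shots b"
      using s by (auto simp: shots_def intro: le_SucI)
    have "i < support_length t" using i shots_eq_0_iff[OF t, of i] by simp
    then have "(\<Sum>j<support_length t. t j - ?s j) < (\<Sum>j<support_length t. t j - s j)"
      using i by (intro sum_strict_mono_ex1) (auto intro!: bexI[of _ i])
    moreover have "?s \<le> t" using le i by (auto simp: le_fun_def)
    ultimately obtain js where "firing_sequence b (config b ?s) js (config b t)"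
      using less.hyps[OF _ s' t] by blast
    then have "firing_sequence b (config b s) (i # js) (config b t)"
      using fireable_config[OF s] fire_config[OF s s'] s' by simp
    then show ?thesis ..
  qed
qed

end

lemma rtranclp_successor_iff: "(successor b)\<^sup>*\<^sup>* p q \<longleftrightarrow> (\<exists>is. firing_sequence b p is q)"
proof
  assume "(successor b)\<^sup>*\<^sup>* p q"
  then show "\<exists>is. firing_sequence b p is q"
  proof (induction rule: converse_rtranclp_induct)
    case base
    show ?case by (rule exI[of _ "[]"]) simp
  next
    case (step p p')
    then obtain i js where "fireable b i p" "p' = fire b i p" "firing_sequence b p' js q"
      by (auto simp: successor_def)
    then show ?case by (intro exI[of _ "i # js"]) simp
  qed
next
  have "firing_sequence b p is q \<Longrightarrow> (successor b)\<^sup>*\<^sup>* p q" for "is"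
  proof (induction "is" arbitrary: p)
    case (Cons i js)
    then have "successor b p (fire b i p)" by (auto simp: successor_def)
    then show ?case using Cons by (auto intro: converse_rtranclp_into_rtranclp)
  qed simp
  then show "\<exists>is. firing_sequence b p is q \<Longrightarrow> (successor b)\<^sup>*\<^sup>* p q" by blast
qed

lemma reach_config_iff:
  assumes b: "b > 1" and s: "s \<in> shots b" and t: "t \<in> shots b"
  shows "(successor b)\<^sup>*\<^sup>* (config b s) (config b t) \<longleftrightarrow> s \<le> t"
proof
  assume "(successor b)\<^sup>*\<^sup>* (config b s) (config b t)"
  then obtain "is" where "firing_sequence b (config b s) is (config b t)"
    by (auto simp: rtranclp_successor_iff)
  from firing_sequence_config[OF b this s] have "t = (\<lambda>i. s i + count_list is i)"
    using config_inject[OF b t] by blast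
  then show "s \<le> t" by (simp add: le_fun_def)
qed (use firing_sequence_exists[OF b s t] in \<open>simp add: rtranclp_successor_iff\<close>)

lemma reach_configD:
  assumes "b > 1" "s \<in> shots b" "(successor b)\<^sup>*\<^sup>* (config b s) q"
  shows "\<exists>t \<in> shots b. q = config b t"
  using assms firing_sequence_config by (metis rtranclp_successor_iff)

text \<open>The tuple \<open>[\<infinity>]\<close> belongs to the zero vector, so every run from it
  to \<open>config b s\<close> has counts \<open>s\<close>; some run exists, so \<open>THE\<close>
  is well defined.\<close>

lemma shot_inf_config:
  assumes b: "b > 1" and s: "s \<in> shots b"
  shows "shot_inf b (config b s) i = s i"
  unfolding shot_inf_def shot_vector_def
proof (rule the_equality)
  have count: "count_list is = s" if "firing_sequence b [\<infinity>] is (config b s)" for "is"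
    using firing_sequence_config[OF b _ shots_zero[OF b], of "is" "config b s"] that
      config_inject[OF b s] by (auto simp: config_zero[OF b])
  moreover obtain "is" where "firing_sequence b [\<infinity>] is (config b s)"
    using firing_sequence_exists[OF b shots_zero[OF b] s] by (auto simp: config_zero[OF b] le_fun_def)
  ultimately show "\<exists>is. firing_sequence b [\<infinity>] is (config b s) \<and> count_list is i = s i"
    by blast
  show "m = s i" if "\<exists>is. firing_sequence b [\<infinity>] is (config b s) \<and> count_list is i = m" for m
    using that count by auto
qed

lemma R_inf_dual_function_lattice:
  assumes b: "b > 1"
  shows "dual_function_lattice (R_inf b) (config b) (shots b)"
proof
  have "(successor b)\<^sup>*\<^sup>* [\<infinity>] p \<longleftrightarrow> p \<in> config b ` shots b" for p
  proof
    show "(successor b)\<^sup>*\<^sup>* [\<infinity>] p \<Longrightarrow> p \<in> config b ` shots b"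
      using reach_configD[OF b shots_zero[OF b]] unfolding config_zero[OF b] by blast
    \<comment> \<open>The zero vector lies below every vector.\<close>
    show "p \<in> config b ` shots b \<Longrightarrow> (successor b)\<^sup>*\<^sup>* [\<infinity>] p"
      using reach_config_iff[OF b shots_zero[OF b]] unfolding config_zero[OF b]
      by (auto simp: le_fun_def)
  qed
  then show "carrier (R_inf b) = config b ` shots b" by (auto simp: R_inf_def)
qed (auto simp: R_inf_def reach_config_iff[OF b] intro: shots_min shots_max)

section \<open>Partitions of \<open>n\<close>\<close>

lemma fireable_shift_inf: "fireable b (Suc i) (shift_inf p) \<longleftrightarrow> fireable b i p"
  by (auto simp: fireable_def shift_inf_def of_nat_eq_enat)

lemma fire_shift_inf:
  assumes "fireable b i p"
  shows "fire b (Suc i) (shift_inf p) = shift_inf (fire b i p)"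
proof -
  define p' where "p' = (if Suc i = length p then p @ [0] else p)"
  have "Suc i < length p'" using assms by (auto simp: p'_def fireable_def)
  then have "(shift_inf p')[Suc i := shift_inf p' ! Suc i - of_nat b,
      Suc (Suc i) := shift_inf p' ! Suc (Suc i) + 1]
      = shift_inf (p'[i := p' ! i - b, Suc i := p' ! Suc i + 1])"
    by (simp add: shift_inf_def map_update of_nat_eq_enat one_enat_def)
  \<comment> \<open>Prepending a part raises index and length alike, so both tuples are padded in
    the same case.\<close>
  moreover have "shift_inf p' =
      (if Suc (Suc i) = length (shift_inf p) then shift_inf p @ [0] else shift_inf p)"
    by (simp add: p'_def shift_inf_def zero_enat_def)
  ultimately show ?thesis by (simp add: fire_def Let_def p'_def)
qed

text \<open>Runs on finite tuples are the runs behind a leading infinite part that never fire index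
  0.\<close>

lemma firing_sequence_shift_inf:
  "firing_sequence b (shift_inf p) (map Suc is) (shift_inf q) \<longleftrightarrow> firing_sequence b p is q"
proof (induction "is" arbitrary: p)
  case Nil
  show ?case by (simp add: inj_eq[OF inj_shift_inf])
next
  case (Cons i js)
  show ?case
  proof (cases "fireable b i p")
    case True
    then show ?thesis
      by (simp only: list.map firing_sequence.simps fireable_shift_inf fire_shift_inf[OF True] Cons.IH)
  qed (simp add: fireable_shift_inf)
qed

text \<open>Equal entries at 0 mean that a run between the two configurations never fires the
  infinite part, so it descends to the finite tuples.\<close>

lemma reach_parts_iff:
  assumes b: "b > 1" and s: "s \<in> shots b" and t: "t \<in> shots b" and eq: "s 0 = t 0"
  shows "(successor b)\<^sup>*\<^sup>* (parts b s) (parts b t) \<longleftrightarrow> s \<le> t"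
proof
  assume "(successor b)\<^sup>*\<^sup>* (parts b s) (parts b t)"
  then have "(successor b)\<^sup>*\<^sup>* (config b s) (config b t)"
    unfolding rtranclp_successor_iff config_def using firing_sequence_shift_inf by blast
  then show "s \<le> t" by (simp add: reach_config_iff[OF b s t])
next
  assume "s \<le> t"
  then obtain "is" where "is": "firing_sequence b (config b s) is (config b t)"
    using firing_sequence_exists[OF b s t] by blast
  from firing_sequence_config[OF b this s] have "t = (\<lambda>i. s i + count_list is i)"
    using config_inject[OF b t] by blast
  from fun_cong[OF this, of 0] have "count_list is 0 = 0" using eq by simp
  then have "0 \<notin> set is" by (simp add: count_list_0_iff)
  \<comment> \<open>Without index 0, predecessor and \<open>Suc\<close> cancel, which exhibits the
    run as a shifted one.\<close>
  then have "map (Suc \<circ> (\<lambda>i. i - 1)) is = is"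
    by (intro map_idI) (metis Suc_pred comp_apply neq0_conv diff_Suc_1 One_nat_def)
  with "is" have "firing_sequence b (parts b s) (map (\<lambda>i. i - 1) is) (parts b t)"
    by (simp add: config_def flip: firing_sequence_shift_inf)
  then show "(successor b)\<^sup>*\<^sup>* (parts b s) (parts b t)"
    by (auto simp: rtranclp_successor_iff)
qed

lemma parts_single: "parts b (\<lambda>i. if i = 0 then n else 0) = one_part n"
proof -
  have "support_length (\<lambda>i. if i = 0 then n else 0) = (if n = 0 then 0 else 1)"
    by (rule support_length_eqI) auto
  then show ?thesis by (simp add: parts_def one_part_def)
qed

lemma bary_partition_parts:
  assumes b: "b > 1" and s: "s \<in> shots b"
  shows "bary_partition b (s 0) (parts b s)"
  unfolding bary_partition_def
proof
  let ?k = "support_length s"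
  note zero = shots_eq_0_iff[OF b s]
  \<comment> \<open>The sum telescopes; the remainder \<open>s m * b ^ m\<close> vanishes at the
    support length.\<close>
  have "(\<Sum>i<m. (s i - b * s (Suc i)) * b ^ i) + s m * b ^ m = s 0" for m
  proof (induction m)
    case (Suc m)
    have "(s m - b * s (Suc m)) * b ^ m + s (Suc m) * b ^ Suc m
        = (s m - b * s (Suc m) + b * s (Suc m)) * b ^ m"
      by (simp add: algebra_simps)
    also have "\<dots> = s m * b ^ m" using shotsD[OF s, of m] by simp
    finally show ?case using Suc by simp
  qed simp
  from this[of ?k] show "s 0 = (\<Sum>i<length (parts b s). parts b s ! i * b ^ i)"
    using zero[of ?k] by simp
  show "parts b s \<noteq> [] \<longrightarrow> last (parts b s) \<noteq> 0"
  proof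
    assume "parts b s \<noteq> []"
    then have k: "?k > 0" by (metis length_greater_0_conv length_parts)
    then have "last (parts b s) = s (?k - 1)"
      using zero[of ?k] \<open>parts b s \<noteq> []\<close> by (simp add: last_conv_nth)
    also have "\<dots> \<noteq> 0" using zero[of "?k - 1"] k by linarith
    finally show "last (parts b s) \<noteq> 0" .
  qed
qed

lemma R_dual_function_lattice:
  assumes b: "b > 1"
  shows "dual_function_lattice (R b n) (parts b) {s \<in> shots b. s 0 = n}"
proof
  \<comment> \<open>Firing the infinite part \<open>n\<close> times and nothing else puts
    \<open>n\<close> into the next part: the starting tuple of \<open>R b n\<close>,
    shifted.\<close>
  let ?e = "\<lambda>i::nat. if i = 0 then n else 0"
  have e: "?e \<in> shots b" by (rule shots_single[OF b])
  have "\<exists>t \<in> shots b. t 0 = n \<and> p = parts b t" if reach: "(successor b)\<^sup>*\<^sup>* (one_part n) p" for p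
  proof -
    obtain "is" where "firing_sequence b (parts b ?e) is p"
      using reach by (auto simp: rtranclp_successor_iff parts_single)
    then have "firing_sequence b (config b ?e) (map Suc is) (shift_inf p)"
      by (simp add: config_def firing_sequence_shift_inf)
    from firing_sequence_config[OF b this e] obtain t where
      t: "t \<in> shots b" "shift_inf p = config b t" "t 0 = n + count_list (map Suc is) 0"
      by fastforce
    \<comment> \<open>A shifted run leaves entry 0 at \<open>n\<close>.\<close>
    moreover have "count_list (map Suc is) 0 = 0" by (auto simp: count_list_0_iff)
    moreover have "p = parts b t"
      using t(2) by (simp add: config_def inj_eq[OF inj_shift_inf])
    ultimately show ?thesis by auto
  qed
  moreover have "(successor b)\<^sup>*\<^sup>* (one_part n) (parts b t)" if "t \<in> shots b" "t 0 = n" for t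
    using reach_parts_iff[OF b e that(1)] that by (simp add: parts_single le_fun_def)
  ultimately show "carrier (R b n) = parts b ` {s \<in> shots b. s 0 = n}"
    using bary_partition_parts[OF b] by (auto simp: R_def)
qed (auto simp: R_def reach_parts_iff[OF b] intro: shots_min shots_max)

text \<open>Entry 0 of \<open>s\<close> occurs only in the first part, which \<open>proj_inf\<close>
  replaces by the infinite one.\<close>

lemma proj_inf_parts:
  assumes b: "b > 1" and s: "s \<in> shots b"
  shows "proj_inf (parts b s) = config b (s \<circ> Suc)"
proof -
  \<comment> \<open>For the empty tuple \<open>0 - 1 = 0\<close> agrees with
    \<open>tl [] = []\<close>.\<close>
  have "support_length (s \<circ> Suc) = support_length s - 1"
    by (rule support_length_eqI) (auto simp: shots_eq_0_iff[OF b s])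
  then have "tl (parts b s) = parts b (s \<circ> Suc)"
    by (intro nth_equalityI) (auto simp: nth_tl)
  then show ?thesis by (simp add: proj_inf_def config_def shift_inf_def)
qed

section \<open>The embeddings\<close>

text \<open>Both lattices compute joins and meets on vectors, so it suffices to study the map
  \<open>\<phi>\<close> that \<open>h\<close> induces on vectors.\<close>

lemma lattice_embeddingI:
  assumes L: "dual_function_lattice L f V" and M: "dual_function_lattice M g W"
    and h: "\<And>s. s \<in> V \<Longrightarrow> h (f s) = g (\<phi> s)"
    and phi: "\<phi> \<in> V \<rightarrow> W" "inj_on \<phi> V" and g: "inj_on g W"
    and min: "\<And>s t. \<phi> (\<lambda>i. min (s i) (t i)) = (\<lambda>i. min (\<phi> s i) (\<phi> t i))"
    and max: "\<And>s t. \<phi> (\<lambda>i. max (s i) (t i)) = (\<lambda>i. max (\<phi> s i) (\<phi> t i))"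
  shows "lattice_embedding L M h"
proof -
  interpret L: dual_function_lattice L f V by (rule L)
  interpret M: dual_function_lattice M g W by (rule M)
  have W: "\<phi> s \<in> W" if "s \<in> V" for s using phi that by auto
  have "h \<in> carrier L \<rightarrow> carrier M"
    by (auto simp: L.carrier_eq M.carrier_eq h W)
  moreover have "s = t" if "s \<in> V" "t \<in> V" "g (\<phi> s) = g (\<phi> t)" for s t
    using that inj_onD[OF g] inj_onD[OF phi(2)] W by metis
  then have "inj_on h (carrier L)" by (auto simp: inj_on_def L.carrier_eq h)
  moreover have "join_pres L M h"
    by (auto simp: join_pres_def L.lattice_L M.lattice_L L.carrier_eq L.join_eq M.join_eq
        L.min_closed h W min)
  moreover have "meet_pres L M h"
    by (auto simp: meet_pres_def L.lattice_L M.lattice_L L.carrier_eq L.meet_eq M.meet_eq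
        L.max_closed h W max)
  ultimately show ?thesis by (simp add: lattice_embedding_def)
qed

lemma proj_inf_embedding:
  assumes b: "b > 1"
  shows "lattice_embedding (R b n) (R_inf b) proj_inf"
proof (rule lattice_embeddingI[OF R_dual_function_lattice[OF b] R_inf_dual_function_lattice[OF b],
      where \<phi> = "\<lambda>s. s \<circ> Suc"])
  show "inj_on (\<lambda>s. s \<circ> Suc) {s \<in> shots b. s 0 = n}"
  proof (rule inj_onI)
    fix s t :: "nat \<Rightarrow> nat"
    assume "s \<in> {s \<in> shots b. s 0 = n}" "t \<in> {s \<in> shots b. s 0 = n}" "s \<circ> Suc = t \<circ> Suc"
    \<comment> \<open>The dropped entry 0 is \<open>n\<close> for both vectors.\<close>
    then have "s i = t i" for i by (cases i) (auto dest: fun_cong)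
    then show "s = t" ..
  qed
qed (use config_inject[OF b] in \<open>auto simp: proj_inf_parts[OF b] shots_tail[OF b] inj_on_def\<close>)

text \<open>By definition \<open>config b s\<close> is \<open>shift_inf (parts b s)\<close>, so the
  induced map on vectors is the inclusion.\<close>

lemma shift_inf_embedding:
  assumes b: "b > 1"
  shows "lattice_embedding (R b n) (R_inf b) shift_inf"
  by (rule lattice_embeddingI[OF R_dual_function_lattice[OF b] R_inf_dual_function_lattice[OF b],
        where \<phi> = "\<lambda>s. s"])
    (use config_inject[OF b] in \<open>auto simp: config_def inj_on_def\<close>)

theorem theorem3:
  fixes b :: nat
  assumes "b > 1"
  shows "distributive_lattice (R_inf b)
    \<and> (\<forall>p \<in> carrier (R_inf b). \<forall>q \<in> carrier (R_inf b). \<forall>i.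
         shot_inf b (p \<squnion>\<^bsub>R_inf b\<^esub> q) i = min (shot_inf b p i) (shot_inf b q i)
       \<and> shot_inf b (p \<sqinter>\<^bsub>R_inf b\<^esub> q) i = max (shot_inf b p i) (shot_inf b q i))
    \<and> (\<forall>n. lattice_embedding (R b n) (R_inf b) proj_inf
         \<and> lattice_embedding (R b n) (R_inf b) shift_inf)"
proof -
  interpret dual_function_lattice "R_inf b" "config b" "shots b"
    by (rule R_inf_dual_function_lattice[OF assms])
  show ?thesis
    using distributive proj_inf_embedding[OF assms] shift_inf_embedding[OF assms]
    by (auto simp: carrier_eq join_eq meet_eq shot_inf_config[OF assms] shots_min shots_max)
qed

end
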